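(* Consider a finite normal form game with player set $I=\{1,\ldots,N\}$, pure strategy sets $S_i=\{s_{i0},\ldots,s_{id_i}\}$ ($d_i\ge 1$) and payoff functions $u_i\colon S\to\mathbb{R}$, and let $D=\sum_{i\in I}d_i$. The sequence of real numbers $$(\sigma_{10},\ldots,\sigma_{1d_1},\ldots,\sigma_{N0},\ldots,\sigma_{Nd_N})$$ constitutes a Nash equilibrium if and only if for some sequence of real numbers $$(v_{10},\ldots,v_{1d_1},\ldots,v_{N0},\ldots,v_{Nd_N}),$$ the $\sigma_{ij}$'s and $v_{ij}$'s satisfy the following system of $2(D+N)$ polynomial equations in $2(D+N)$ unknowns: $$u_i(s_{ij},\sigma_{-i})+v_{ij}=u_i(s_{i0},\sigma_{-i})+v_{i0}\quad\text{for each } i\in I \text{ and } j=1,\ldots,d_i,$$ $$\sigma_{ij}v_{ij}=0\quad\text{for each } i\in I\text{ and } j=0,\ldots,d_i,$$ $$\sum_{j=0}^{d_i}\sigma_{ij}=1\quad\text{for each } i\in I,$$ and all the $\sigma_{ij}$'s and $v_{ij}$'s are nonnegative.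
   Context: A finite normal form game consists of a set of players $I=\{1,\ldots,N\}$, finite disjoint sets of pure strategies $S_i=\{s_{i0},\ldots,s_{id_i}\}$ with $|S_i|=d_i+1\ge 2$ for each $i\in I$, and payoff functions $u_i\colon S\to\mathbb{R}$ for each $i \in I$, where $S=\prod_{i\in I}S_i$. A mixed strategy of player $i$ is a function $\sigma_i\colon S_i\to[0,1]$ with $\sum_{j=0}^{d_i}\sigma_i(s_{ij})=1$; write $\sigma_{ij}=\sigma_i(s_{ij})$. A strategy profile is a tuple $\sigma=(\sigma_1,\ldots,\sigma_N)$ of mixed strategies, and $\sigma_{-i}$ denotes the tuple obtained from $\sigma$ by omitting the $i$th component. The expected payoff is $$u_i(\sigma)=\sum_{s=(s_1,\ldots,s_N)\in S}u_i(s)\,\sigma_1(s_1)\cdots\sigma_N(s_N),$$ also written $u_i(\sigma_i,\sigma_{-i})$. Let $S_{-i}=\prod_{k\in I\setminus\{i\}}S_k$. The expression $u_i(s_{ij},\sigma_{-i})$ denotes the polynomial $$u_i(s_{ij},\sigma_{-i})=\sum_{s_{-i}\in S_{-i}}u_i(s_{ij},s_{-i})\prod_{k\in I\setminus\{i\}}\sigma_{k l_k},\qquad s_{-i}=(s_{kl_k})_{k\in I\setminus\{i\}},$$ in the variables $\sigma_{kl}$, $k\ne i$; it makes sense for arbitrary real numbers $\sigma_{kl}$. A strategy profile $\sigma^*$ is a Nash equilibrium if for each player $i$ and every mixed strategy $\sigma_i$ of player $i$, $u_i(\sigma_i^*,\sigma_{-i}^* )\ge u_i(\sigma_i,\sigma_{-i}^*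 )$. A sequence of real numbers $(\sigma_{ij})$ constitutes a Nash equilibrium if setting $\sigma_i(s_{ij})=\sigma_{ij}$ defines a strategy profile that is a Nash equilibrium. *)

theory Defs
  imports Complex_Main "HOL-Library.FuncSet" "HOL-Library.Disjoint_Sets"
begin

(* max_index G i is d_i and strat G i j is s_ij, so that S_i has d_i + 1 elements.
   Pure strategy profiles are extensional functions on the players; the values of
   payoff G i outside pure_profiles G (defined below) are never used. *)
record 's game =
  num_players :: nat
  max_index :: "nat \<Rightarrow> nat"
  strat :: "nat \<Rightarrow> nat \<Rightarrow> 's"
  payoff :: "nat \<Rightarrow> (nat \<Rightarrow> 's) \<Rightarrow> real"

definition players :: "'s game \<Rightarrow> nat set" where
  "players G = {1..num_players G}"

definition pure_strategies :: "'s game \<Rightarrow> nat \<Rightarrow> 's set" where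
  "pure_strategies G i = strat G i ` {0..max_index G i}"

definition finite_normal_form_game :: "'s game \<Rightarrow> bool" where
  "finite_normal_form_game G \<longleftrightarrow>
     (\<forall>i\<in>players G. max_index G i \<ge> 1 \<and> inj_on (strat G i) {0..max_index G i}) \<and>
     disjoint_family_on (pure_strategies G) (players G)"

definition pure_profiles :: "'s game \<Rightarrow> (nat \<Rightarrow> 's) set" where
  "pure_profiles G = PiE (players G) (pure_strategies G)"

definition opponent_profiles :: "'s game \<Rightarrow> nat \<Rightarrow> (nat \<Rightarrow> 's) set" where
  "opponent_profiles G i = PiE (players G - {i}) (pure_strategies G)"

definition mixed_strategies :: "'s game \<Rightarrow> nat \<Rightarrow> ('s \<Rightarrow> real) set" where
  "mixed_strategies G i =
     {\<tau> \<in> pure_strategies G i \<rightarrow>\<^sub>E {0..1}. (\<Sum>j=0..max_index G i. \<tau> (strat G i j)) = 1}"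

definition strategy_profiles :: "'s game \<Rightarrow> (nat \<Rightarrow> 's \<Rightarrow> real) set" where
  "strategy_profiles G = PiE (players G) (mixed_strategies G)"

definition expected_payoff :: "'s game \<Rightarrow> nat \<Rightarrow> (nat \<Rightarrow> 's \<Rightarrow> real) \<Rightarrow> real" where
  "expected_payoff G i \<tau> =
     (\<Sum>a\<in>pure_profiles G. payoff G i a * (\<Prod>k\<in>players G. \<tau> k (a k)))"

definition nash_equilibrium :: "'s game \<Rightarrow> (nat \<Rightarrow> 's \<Rightarrow> real) \<Rightarrow> bool" where
  "nash_equilibrium G \<tau> \<longleftrightarrow> \<tau> \<in> strategy_profiles G \<and>
     (\<forall>i\<in>players G. \<forall>\<rho>\<in>mixed_strategies G i.
        expected_payoff G i \<tau> \<ge> expected_payoff G i (\<tau>(i := \<rho>)))"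

(* The index j for which a = s_ij; well defined because strat G i is injective. *)
definition strat_index :: "'s game \<Rightarrow> nat \<Rightarrow> 's \<Rightarrow> nat" where
  "strat_index G i = the_inv_into {0..max_index G i} (strat G i)"

(* The polynomial u_i(s_ij, sigma_{-i}), evaluated at arbitrary real numbers sigma_kl. *)
definition pure_payoff :: "'s game \<Rightarrow> nat \<Rightarrow> nat \<Rightarrow> (nat \<Rightarrow> nat \<Rightarrow> real) \<Rightarrow> real" where
  "pure_payoff G i j \<sigma> =
     (\<Sum>a\<in>opponent_profiles G i. payoff G i (a(i := strat G i j)) *
        (\<Prod>k\<in>players G - {i}. \<sigma> k (strat_index G k (a k))))"

(* The functions sigma_i on S_i with sigma_i(s_ij) = sigma_ij. *)
definition profile_of_numbers ::
    "'s game \<Rightarrow> (nat \<Rightarrow> nat \<Rightarrow> real) \<Rightarrow> nat \<Rightarrow> 's \<Rightarrow> real" where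
  "profile_of_numbers G \<sigma> =
     (\<lambda>i\<in>players G. \<lambda>a\<in>pure_strategies G i. \<sigma> i (strat_index G i a))"

definition constitutes_nash_equilibrium :: "'s game \<Rightarrow> (nat \<Rightarrow> nat \<Rightarrow> real) \<Rightarrow> bool" where
  "constitutes_nash_equilibrium G \<sigma> \<longleftrightarrow> nash_equilibrium G (profile_of_numbers G \<sigma>)"

end

theory Submission
  imports Defs
begin

text \<open>
  Player i's expected payoff is linear in her own mixed strategy, the coefficients being the
  payoffs of her pure strategies against the others. A mixed strategy is therefore a best response
  iff it only charges maximising pure strategies; the unknown v_ij is the amount by which s_ij
  falls short of the maximum, and the products sigma_ij v_ij = 0 are complementary slackness.
\<close>

text \<open>The problem of a single player, stripped of the game: \<open>u\<close> holds the payoffs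
  of the pure strategies, \<open>p\<close> and \<open>q\<close> are mixtures. \<open>m\<close> turns
  out to be the maximal payoff and \<open>v\<close> the shortfall from it.\<close>

lemma optimal_mixture_iff_slack:
  fixes p u :: "'a \<Rightarrow> real"
  assumes fin: "finite J" and nonneg: "\<And>j. j \<in> J \<Longrightarrow> 0 \<le> p j" and total: "sum p J = 1"
  shows "(\<forall>q :: 'a \<Rightarrow> real. (\<forall>j\<in>J. 0 \<le> q j) \<and> sum q J = 1 \<longrightarrow>
            (\<Sum>j\<in>J. q j * u j) \<le> (\<Sum>j\<in>J. p j * u j)) \<longleftrightarrow>
         (\<exists>m v. \<forall>j\<in>J. u j + v j = m \<and> p j * v j = 0 \<and> 0 \<le> v j)"
    (is "?opt \<longleftrightarrow> ?slack")
proof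
  assume opt: ?opt
  define m where "m = (\<Sum>j\<in>J. p j * u j)"
  \<comment> \<open>Compare \<open>p\<close> with the point mass at \<open>k\<close>.\<close>
  have le: "u k \<le> m" if "k \<in> J" for k
    using spec[OF opt, of "\<lambda>j. if j = k then 1 else 0"] that fin
    by (simp add: m_def if_distrib[of "\<lambda>x. x * _"] cong: if_cong)
  \<comment> \<open>The average shortfall under \<open>p\<close> vanishes; as every summand is
    nonnegative, each one must be zero.\<close>
  have "(\<Sum>j\<in>J. p j * (m - u j)) = m * sum p J - m"
    by (simp add: right_diff_distrib sum_subtractf mult.commute[of m] flip: m_def sum_distrib_right)
  also have "\<dots> = 0"
    by (simp add: total)
  finally have "\<forall>j\<in>J. p j * (m - u j) = 0"
    using fin nonneg le by (simp add: sum_nonneg_eq_0_iff)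
  then have "\<forall>j\<in>J. u j + (m - u j) = m \<and> p j * (m - u j) = 0 \<and> 0 \<le> m - u j"
    using le by simp
  then show ?slack
    by (intro exI[of _ m] exI[of _ "\<lambda>j. m - u j"])
next
  assume ?slack
  then obtain m v where v: "\<And>j. j \<in> J \<Longrightarrow> u j + v j = m \<and> p j * v j = 0 \<and> 0 \<le> v j"
    by blast
  \<comment> \<open>For a mixture the value is \<open>m\<close> minus the average slack, which is
    nonnegative for \<open>q\<close> and zero for \<open>p\<close>.\<close>
  have expand: "(\<Sum>j\<in>J. q j * u j) = m * sum q J - (\<Sum>j\<in>J. q j * v j)" for q
  proof -
    have "(\<Sum>j\<in>J. q j * u j) = (\<Sum>j\<in>J. m * q j - q j * v j)"
      using v by (intro sum.cong refl) (force simp: algebra_simps)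
    then show ?thesis
      by (simp add: sum_subtractf sum_distrib_left)
  qed
  show ?opt
  proof (intro allI impI)
    fix q :: "'a \<Rightarrow> real"
    assume q: "(\<forall>j\<in>J. 0 \<le> q j) \<and> sum q J = 1"
    have "0 \<le> (\<Sum>j\<in>J. q j * v j)"
      using q v by (intro sum_nonneg mult_nonneg_nonneg) auto
    moreover have "(\<Sum>j\<in>J. p j * v j) = 0"
      using v by (intro sum.neutral) blast
    ultimately show "(\<Sum>j\<in>J. q j * u j) \<le> (\<Sum>j\<in>J. p j * u j)"
      using q by (simp add: expand total)
  qed
qed

context
  fixes G :: "'s game"
  assumes game: "finite_normal_form_game G"
begin

lemma inj_on_strat: "i \<in> players G \<Longrightarrow> inj_on (strat G i) {0..max_index G i}"
  using game by (simp add: finite_normal_form_game_def)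

lemma strat_index_strat:
  "i \<in> players G \<Longrightarrow> j \<le> max_index G i \<Longrightarrow> strat_index G i (strat G i j) = j"
  unfolding strat_index_def using inj_on_strat by (intro the_inv_into_f_f) auto

lemma profile_of_numbers_strat:
  "i \<in> players G \<Longrightarrow> j \<le> max_index G i \<Longrightarrow> profile_of_numbers G \<sigma> i (strat G i j) = \<sigma> i j"
  by (simp add: profile_of_numbers_def pure_strategies_def strat_index_strat)

text \<open>The bound by 1 in \<open>mixed_strategies\<close> follows from nonnegativity and total
  mass 1, and extensionality is built into \<open>profile_of_numbers\<close>.\<close>

lemma profile_of_numbers_mixed_iff:
  assumes "i \<in> players G"
  shows "profile_of_numbers G \<sigma> i \<in> mixed_strategies G i \<longleftrightarrow>
    (\<forall>j\<in>{0..max_index G i}. 0 \<le> \<sigma> i j) \<and> (\<Sum>j=0..max_index G i. \<sigma> i j) = 1"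
    (is "?L \<longleftrightarrow> ?R")
proof -
  have sum_eq: "(\<Sum>j=0..max_index G i. profile_of_numbers G \<sigma> i (strat G i j)) =
      (\<Sum>j=0..max_index G i. \<sigma> i j)"
    by (intro sum.cong) (simp_all add: assms profile_of_numbers_strat)
  have ext: "profile_of_numbers G \<sigma> i \<in> extensional (pure_strategies G i)"
    by (simp add: assms profile_of_numbers_def)
  have le_1: "\<sigma> i j \<le> 1" if ?R "j \<le> max_index G i" for j
    using that member_le_sum[of j "{0..max_index G i}" "\<sigma> i"] by auto
  show ?thesis
    using ext le_1
    by (auto simp: mixed_strategies_def sum_eq PiE_def Pi_def pure_strategies_def
        profile_of_numbers_strat assms)
qed

lemma profile_of_numbers_profile_iff:
  "profile_of_numbers G \<sigma> \<in> strategy_profiles G \<longleftrightarrow>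
    (\<forall>i\<in>players G. (\<forall>j\<in>{0..max_index G i}. 0 \<le> \<sigma> i j) \<and> (\<Sum>j=0..max_index G i. \<sigma> i j) = 1)"
proof -
  have "profile_of_numbers G \<sigma> \<in> extensional (players G)"
    by (simp add: profile_of_numbers_def)
  then show ?thesis
    by (simp add: strategy_profiles_def PiE_iff profile_of_numbers_mixed_iff)
qed

text \<open>This is linearity in the player's own strategy: splitting a pure profile into the own
  choice and the opponents' choices lets the factor \<open>\<rho> s\<close> be pulled out of the
  inner sum.\<close>

lemma expected_payoff_deviation:
  assumes i: "i \<in> players G"
  shows "expected_payoff G i ((profile_of_numbers G \<sigma>)(i := \<rho>)) =
    (\<Sum>j=0..max_index G i. \<rho> (strat G i j) * pure_payoff G i j \<sigma>)"
proof -
  let ?\<tau> = "profile_of_numbers G \<sigma>"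
  let ?P = "players G - {i}"
  let ?w = "\<lambda>a. payoff G i a * (\<Prod>k\<in>players G. (?\<tau>(i := \<rho>)) k (a k))"
  have fin: "finite (players G)"
    by (simp add: players_def)
  have "pure_profiles G = PiE (insert i ?P) (pure_strategies G)"
    using i by (simp add: pure_profiles_def insert_absorb)
  then have profiles: "pure_profiles G =
      (\<lambda>(s, a). a(i := s)) ` (pure_strategies G i \<times> opponent_profiles G i)"
    by (simp only: PiE_insert_eq opponent_profiles_def)
  have inj: "inj_on (\<lambda>(s, a). a(i := s)) (pure_strategies G i \<times> opponent_profiles G i)"
    unfolding opponent_profiles_def by (intro inj_combinator) simp
  \<comment> \<open>The update at \<open>i\<close> affects only the factor of player
    \<open>i\<close>; the opponents' factors are still the numbers in
    \<open>\<sigma>\<close>.\<close>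
  have weight: "?w (a(i := s)) =
      \<rho> s * (payoff G i (a(i := s)) * (\<Prod>k\<in>?P. \<sigma> k (strat_index G k (a k))))"
    if a: "a \<in> opponent_profiles G i" for s a
  proof -
    have "(\<Prod>k\<in>?P. (?\<tau>(i := \<rho>)) k ((a(i := s)) k)) = (\<Prod>k\<in>?P. \<sigma> k (strat_index G k (a k)))"
      using a by (intro prod.cong)
        (auto simp: opponent_profiles_def profile_of_numbers_def dest: PiE_mem)
    then show ?thesis
      by (subst prod.remove[OF fin i]) simp
  qed
  have "expected_payoff G i (?\<tau>(i := \<rho>)) =
      (\<Sum>(s, a)\<in>pure_strategies G i \<times> opponent_profiles G i. ?w (a(i := s)))"
    unfolding expected_payoff_def profiles
    by (subst sum.reindex[OF inj]) (simp add: case_prod_unfold)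
  also have "\<dots> = (\<Sum>s\<in>pure_strategies G i. \<Sum>a\<in>opponent_profiles G i. ?w (a(i := s)))"
    by (rule sum.cartesian_product[symmetric])
  also have "\<dots> = (\<Sum>s\<in>pure_strategies G i. \<rho> s * (\<Sum>a\<in>opponent_profiles G i.
      payoff G i (a(i := s)) * (\<Prod>k\<in>?P. \<sigma> k (strat_index G k (a k)))))"
    unfolding sum_distrib_left by (intro sum.cong refl weight)
  also have "\<dots> = (\<Sum>j=0..max_index G i. \<rho> (strat G i j) * pure_payoff G i j \<sigma>)"
    unfolding pure_strategies_def
    by (subst sum.reindex[OF inj_on_strat[OF i]]) (simp add: pure_payoff_def)
  finally show ?thesis .
qed

text \<open>The trivial deviation, in which player \<open>i\<close> keeps the same strategy.\<close>

lemma expected_payoff_profile_of_numbers: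
  assumes i: "i \<in> players G"
  shows "expected_payoff G i (profile_of_numbers G \<sigma>) =
    (\<Sum>j=0..max_index G i. \<sigma> i j * pure_payoff G i j \<sigma>)"
  using expected_payoff_deviation[OF i, of \<sigma> "profile_of_numbers G \<sigma> i"]
  by (simp add: i profile_of_numbers_strat)

text \<open>Passes from deviations that are functions on \<open>pure_strategies G i\<close> to
  weight vectors on indices, the form to which \<open>optimal_mixture_iff_slack\<close>
  applies.\<close>

lemma best_response_iff:
  assumes i: "i \<in> players G"
  shows "(\<forall>\<rho>\<in>mixed_strategies G i. expected_payoff G i ((profile_of_numbers G \<sigma>)(i := \<rho>))
      \<le> expected_payoff G i (profile_of_numbers G \<sigma>)) \<longleftrightarrow>
    (\<forall>q :: nat \<Rightarrow> real. (\<forall>j\<in>{0..max_index G i}. 0 \<le> q j) \<and> sum q {0..max_index G i} = 1 \<longrightarrow>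
      (\<Sum>j=0..max_index G i. q j * pure_payoff G i j \<sigma>)
      \<le> (\<Sum>j=0..max_index G i. \<sigma> i j * pure_payoff G i j \<sigma>))"
    (is "?L \<longleftrightarrow> ?R")
proof
  assume L: ?L
  show ?R
  proof (intro allI impI)
    fix q :: "nat \<Rightarrow> real"
    assume "(\<forall>j\<in>{0..max_index G i}. 0 \<le> q j) \<and> sum q {0..max_index G i} = 1"
    \<comment> \<open>The constant family is a device to turn \<open>q\<close> into a strategy of
      player \<open>i\<close>; only its component at \<open>i\<close> is used.\<close>
    then have "profile_of_numbers G (\<lambda>_. q) i \<in> mixed_strategies G i"
      by (simp add: profile_of_numbers_mixed_iff i)
    from bspec[OF L this]
    show "(\<Sum>j=0..max_index G i. q j * pure_payoff G i j \<sigma>)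
        \<le> (\<Sum>j=0..max_index G i. \<sigma> i j * pure_payoff G i j \<sigma>)"
      by (simp add: i expected_payoff_deviation expected_payoff_profile_of_numbers
          profile_of_numbers_strat)
  qed
next
  assume R: ?R
  show ?L
  proof
    fix \<rho> assume "\<rho> \<in> mixed_strategies G i"
    then have "(\<forall>j\<in>{0..max_index G i}. 0 \<le> \<rho> (strat G i j)) \<and>
        (\<Sum>j=0..max_index G i. \<rho> (strat G i j)) = 1"
      by (auto simp: mixed_strategies_def pure_strategies_def PiE_iff)
    with R show "expected_payoff G i ((profile_of_numbers G \<sigma>)(i := \<rho>))
        \<le> expected_payoff G i (profile_of_numbers G \<sigma>)"
      by (simp add: i expected_payoff_deviation expected_payoff_profile_of_numbers)
  qed
qed

text \<open>The slack criterion applies once \<open>\<sigma> i\<close> is a probability vector,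
  which membership in \<open>strategy_profiles\<close> supplies. Here \<open>m\<close> and
  \<open>v\<close> are still chosen separately for each player.\<close>

lemma constitutes_nash_equilibrium_iff_slack:
  "constitutes_nash_equilibrium G \<sigma> \<longleftrightarrow>
    (\<forall>i\<in>players G. (\<forall>j\<in>{0..max_index G i}. 0 \<le> \<sigma> i j) \<and> (\<Sum>j=0..max_index G i. \<sigma> i j) = 1 \<and>
      (\<exists>m v. \<forall>j\<in>{0..max_index G i}.
        pure_payoff G i j \<sigma> + v j = m \<and> \<sigma> i j * v j = 0 \<and> 0 \<le> v j))"
proof -
  have "(\<forall>\<rho>\<in>mixed_strategies G i. expected_payoff G i ((profile_of_numbers G \<sigma>)(i := \<rho>))
      \<le> expected_payoff G i (profile_of_numbers G \<sigma>)) \<longleftrightarrow>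
    (\<exists>m v. \<forall>j\<in>{0..max_index G i}.
      pure_payoff G i j \<sigma> + v j = m \<and> \<sigma> i j * v j = 0 \<and> 0 \<le> v j)"
    if "i \<in> players G" "\<forall>j\<in>{0..max_index G i}. 0 \<le> \<sigma> i j" "(\<Sum>j=0..max_index G i. \<sigma> i j) = 1"
    for i
    unfolding best_response_iff[OF that(1)] using that
    by (intro optimal_mixture_iff_slack) auto
  then show ?thesis
    unfolding constitutes_nash_equilibrium_def nash_equilibrium_def profile_of_numbers_profile_iff
    by blast
qed

end

theorem proposition1:
  fixes G :: "'s game" and \<sigma> :: "nat \<Rightarrow> nat \<Rightarrow> real"
    and I :: "nat set" and d :: "nat \<Rightarrow> nat" and N D :: nat
  defines "I \<equiv> players G" and "N \<equiv> num_players G" and "d \<equiv> max_index G"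
    and "D \<equiv> (\<Sum>i\<in>I. d i)"
  assumes "finite_normal_form_game G"
  shows
    "(constitutes_nash_equilibrium G \<sigma> \<longleftrightarrow>
      (\<exists>v :: nat \<Rightarrow> nat \<Rightarrow> real.
        (\<forall>(i, j)\<in>Sigma I (\<lambda>i. {1..d i}).
           pure_payoff G i j \<sigma> + v i j = pure_payoff G i 0 \<sigma> + v i 0) \<and>
        (\<forall>(i, j)\<in>Sigma I (\<lambda>i. {0..d i}). \<sigma> i j * v i j = 0) \<and>
        (\<forall>i\<in>I. (\<Sum>j=0..d i. \<sigma> i j) = 1) \<and>
        (\<forall>(i, j)\<in>Sigma I (\<lambda>i. {0..d i}). \<sigma> i j \<ge> 0 \<and> v i j \<ge> 0))) \<and>
     card (Sigma I (\<lambda>i. {1..d i})) + card (Sigma I (\<lambda>i. {0..d i})) + card I = 2 * (D + N) \<and>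
     card (Sigma I (\<lambda>i. {0..d i})) + card (Sigma I (\<lambda>i. {0..d i})) = 2 * (D + N)"
proof -
  let ?slack = "\<lambda>v i. \<forall>j\<in>{0..d i}. \<sigma> i j * v j = 0 \<and> 0 \<le> v j"
  \<comment> \<open>Eliminates \<open>m\<close>: the level must be the value at index 0, so
    equations remain only for the indices from 1 on.\<close>
  have common_level: "(\<exists>m. \<forall>j\<in>{0..d i}. pure_payoff G i j \<sigma> + v j = m) \<longleftrightarrow>
      (\<forall>j\<in>{1..d i}. pure_payoff G i j \<sigma> + v j = pure_payoff G i 0 \<sigma> + v 0)" for i v
  proof -
    have "{0..d i} = insert 0 {1..d i}"
      by auto
    then show ?thesis
      by (simp only: ball_simps) auto
  qed
  have "constitutes_nash_equilibrium G \<sigma> \<longleftrightarrow>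
      (\<forall>i\<in>I. (\<forall>j\<in>{0..d i}. 0 \<le> \<sigma> i j) \<and> (\<Sum>j=0..d i. \<sigma> i j) = 1 \<and>
        (\<exists>v. (\<exists>m. \<forall>j\<in>{0..d i}. pure_payoff G i j \<sigma> + v j = m) \<and> ?slack v i))"
    unfolding constitutes_nash_equilibrium_iff_slack[OF assms(5)] I_def d_def by meson
  also have "\<dots> \<longleftrightarrow> (\<forall>i\<in>I. \<exists>v. (\<forall>j\<in>{0..d i}. 0 \<le> \<sigma> i j) \<and> (\<Sum>j=0..d i. \<sigma> i j) = 1 \<and>
        (\<forall>j\<in>{1..d i}. pure_payoff G i j \<sigma> + v j = pure_payoff G i 0 \<sigma> + v 0) \<and> ?slack v i)"
    unfolding common_level by simp
  also have "\<dots> \<longleftrightarrow> (\<exists>v. \<forall>i\<in>I. (\<forall>j\<in>{0..d i}. 0 \<le> \<sigma> i j) \<and> (\<Sum>j=0..d i. \<sigma> i j) = 1 \<and>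
        (\<forall>j\<in>{1..d i}. pure_payoff G i j \<sigma> + v i j = pure_payoff G i 0 \<sigma> + v i 0) \<and>
        ?slack (v i) i)"
    \<comment> \<open>Choice merges the slack vectors of the individual players into one doubly
      indexed \<open>v\<close>.\<close>
    by (rule bchoice_iff)
  also have "\<dots> \<longleftrightarrow> (\<exists>v.
        (\<forall>(i, j)\<in>Sigma I (\<lambda>i. {1..d i}).
           pure_payoff G i j \<sigma> + v i j = pure_payoff G i 0 \<sigma> + v i 0) \<and>
        (\<forall>(i, j)\<in>Sigma I (\<lambda>i. {0..d i}). \<sigma> i j * v i j = 0) \<and>
        (\<forall>i\<in>I. (\<Sum>j=0..d i. \<sigma> i j) = 1) \<and>
        (\<forall>(i, j)\<in>Sigma I (\<lambda>i. {0..d i}). \<sigma> i j \<ge> 0 \<and> v i j \<ge> 0))"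
    unfolding split_paired_Ball_Sigma by (intro arg_cong[of _ _ Ex] ext) blast
  \<comment> \<open>What remains is counting: the equations number D + (D + N) + N, the unknowns (D
    + N) + (D + N), since the sum of \<open>d i + 1\<close> over the players is D + N.\<close>
  finally show ?thesis
    by (simp add: D_def N_def I_def players_def sum_Suc)
qed

end
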